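(* Let $\nu\in\Delta_{\mathcal X}$ and let $C$ be a convex closed subset of $\Delta_{\mathcal X}$ with support $\mathcal X$. Then $\hat\ell_{\mathcal P}$ is finite, $S_{\mathcal P}$ is compact, and there is $\hat q^a_{\mathcal P}\in C^a$ with $\hat q^a_{\mathcal P}>0$ such that $$S_{\mathcal P}=\{\hat q^a_{\mathcal P}\}\times C^p(\hat q^a_{\mathcal P}).$$ Moreover: (a) If $\sum\hat q^a_{\mathcal P}=1$ then $C^p(\hat q^a_{\mathcal P})=\{0^p\}$ and $S_{\mathcal P}=\{(\hat q^a_{\mathcal P},0^p)\}$ is a singleton. (b) If $\sum\hat q^a_{\mathcal P}<1$ then $0^p\notin C^p(\hat q^a_{\mathcal P})$, and $S_{\mathcal P}$ is a singleton if and only if $C^p(\hat q^a_{\mathcal P})$ is a singleton.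
   Context: $\mathcal X$ is a finite nonempty set with $m$ elements; $\mathbb R^m$ is identified with $\mathbb R^{\mathcal X}$. Relations and functions of vectors are componentwise, $\sum x$ is the sum of the coordinates of $x$, and $\langle\cdot,\cdot\rangle$ is the scalar product. $\Delta_{\mathcal X}=\{q\in\mathbb R^m: q\ge 0,\ \sum q=1\}$. Conventions: $\log 0=-\infty$, $0\cdot(-\infty)=0$. For $\nu\in\Delta_{\mathcal X}$ the active and passive alphabets are $\mathcal X^a=\{i:\nu_i>0\}$, $\mathcal X^p=\{i:\nu_i=0\}$, with $m_a,m_p$ elements ($\mathbb R^{0}=\{0\}$). Write $x=(x^a,x^p)\in\mathbb R^{m_a}\times\mathbb R^{m_p}$ for the projections of $x\in\mathbb R^m$ to the active and passive coordinates; $0^p$ is the zero vector of $\mathbb R^{m_p}$. For $M\subseteq\mathbb R^m$, $M^a$ and $M^p$ are its projections to the active and passive coordinates, and $M^p(x^a)=\{x^p:(x^a,x^p)\in M\}$ is a slice. The support of $C$ is $\{i\in\mathcal X:\ q_i>0\text{ for some }q\in C\}$. The primal problem: $\ell(q)=-\langle\nu,\log q\rangle$ for $q\in\Delta_{\mathcal X}$, $\hat\ell_{\mathcal P}=\inf_{q\in C}\ell(q)$, $S_{\mathcal P}=\{\hat q\in C:\ell(\hat q)=\hat\ell_{\mathcal P}\}$. *)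

theory Defs
  imports "HOL-Analysis.Analysis"
begin

text \<open>The alphabet is a finite type \<open>'n\<close>, and vectors of $R^m$ are elements of
  \<open>real ^ 'n\<close>.\<close>

definition prob_simplex :: "(real ^ 'n) set" where
  "prob_simplex = {q. (\<forall>i. 0 \<le> q $ i) \<and> (\<Sum>i\<in>UNIV. q $ i) = 1}"

definition support :: "(real ^ 'n) set \<Rightarrow> 'n set" where
  "support C = {i. \<exists>q\<in>C. 0 < q $ i}"

definition active_set :: "real ^ 'n \<Rightarrow> 'n set" where
  "active_set \<nu> = {i. 0 < \<nu> $ i}"

definition passive_set :: "real ^ 'n \<Rightarrow> 'n set" where
  "passive_set \<nu> = {i. \<nu> $ i = 0}"

text \<open>The alphabets \<open>active_set \<nu>\<close> and \<open>passive_set \<nu>\<close> depend on a term, so the coordinate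
  spaces over them are not of the form \<open>real ^ 'k\<close>. A vector indexed by a set \<open>I\<close> of letters
  is an element of \<open>extensional I\<close>, that is, a function that is \<open>undefined\<close> outside \<open>I\<close>.
  For empty \<open>I\<close> this space has exactly one element.\<close>

definition proj_active :: "real ^ 'n \<Rightarrow> real ^ 'n \<Rightarrow> 'n \<Rightarrow> real" where
  "proj_active \<nu> x = restrict (($) x) (active_set \<nu>)"

definition zero_passive :: "real ^ 'n \<Rightarrow> 'n \<Rightarrow> real" where
  "zero_passive \<nu> = restrict (\<lambda>_. 0) (passive_set \<nu>)"

text \<open>The identification of pairs $(x^a, x^p)$ with vectors $x$.\<close>

definition join :: "real ^ 'n \<Rightarrow> ('n \<Rightarrow> real) \<times> ('n \<Rightarrow> real) \<Rightarrow> real ^ 'n" where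
  "join \<nu> = (\<lambda>(xa, xp). \<chi> i. if i \<in> active_set \<nu> then xa i else xp i)"

lemma bij_betw_join:
  assumes "\<nu> \<in> prob_simplex"
  shows "bij_betw (join \<nu>) (extensional (active_set \<nu>) \<times> extensional (passive_set \<nu>)) UNIV"
proof (rule bij_betw_byWitness[where
      f' = "\<lambda>x. (proj_active \<nu> x, restrict (($) x) (passive_set \<nu>))"])
  have "i \<in> passive_set \<nu> \<longleftrightarrow> i \<notin> active_set \<nu>" for i
    using assms by (auto simp: prob_simplex_def active_set_def passive_set_def less_le)
  then show "\<forall>x\<in>extensional (active_set \<nu>) \<times> extensional (passive_set \<nu>).
      (proj_active \<nu> (join \<nu> x), restrict (($) (join \<nu> x)) (passive_set \<nu>)) = x"
    and "\<forall>x\<in>UNIV. join \<nu> (proj_active \<nu> x, restrict (($) x) (passive_set \<nu>)) = x"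
    by (auto simp: join_def proj_active_def vec_eq_iff fun_eq_iff extensional_def)
qed (auto simp: proj_active_def)

definition slice_passive ::
    "real ^ 'n \<Rightarrow> (real ^ 'n) set \<Rightarrow> ('n \<Rightarrow> real) \<Rightarrow> ('n \<Rightarrow> real) set" where
  "slice_passive \<nu> M xa = {xp \<in> extensional (passive_set \<nu>). join \<nu> (xa, xp) \<in> M}"

text \<open>The logarithm on $[0, \infty)$ with $\log 0 = -\infty$; negative arguments are not used.
  The convention $0 \cdot (-\infty) = 0$ is that of \<open>ereal\<close>. On the simplex all summands of
  \<open>loss\<close> have the same sign, so no $\infty - \infty$ arises.\<close>

definition elog :: "real \<Rightarrow> ereal" where
  "elog t = (if t = 0 then -\<infinity> else ereal (ln t))"

definition loss :: "real ^ 'n \<Rightarrow> real ^ 'n \<Rightarrow> ereal" where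
  "loss \<nu> q = - (\<Sum>i\<in>UNIV. ereal (\<nu> $ i) * elog (q $ i))"

definition primal_value :: "real ^ 'n \<Rightarrow> (real ^ 'n) set \<Rightarrow> ereal" where
  "primal_value \<nu> C = (INF q\<in>C. loss \<nu> q)"

definition primal_solutions :: "real ^ 'n \<Rightarrow> (real ^ 'n) set \<Rightarrow> (real ^ 'n) set" where
  "primal_solutions \<nu> C = {q \<in> C. loss \<nu> q = primal_value \<nu> C}"

end

theory Submission
  imports Defs
begin

text \<open>The loss is minus the logarithm of the likelihood
  $g(q) = \prod_{i \in \mathcal X^a} q_i^{\nu_i}$, the conventions for $\log 0$ matching the value
  $g(q) = 0$ (\<open>loss_eq_likelihood\<close>). Minimising the loss, which takes infinite values, thus amounts to
  maximising $g$, which is finite and continuous on the whole simplex. Compactness of \<open>C\<close> gives a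
  maximiser. The maximum is positive: since every letter is charged by some point of \<open>C\<close>, the
  barycentre of such points is a strictly positive point of \<open>C\<close> (\<open>full_support_imp_positive_point\<close>).
  Hence the optimal value is finite, the solution set is a closed level set of $g$ in \<open>C\<close>, and the
  active coordinates of every solution are positive.

  Two solutions have the same active part by strict concavity: at the midpoint of two points
  with positive likelihood, $g$ is strictly larger than the geometric mean of its two values, unless the active
  coordinates agree (\<open>likelihood_midpoint\<close>). Conversely $g$ depends on the active coordinates only,
  so the solutions are exactly the points of \<open>C\<close> with the optimal active part. What the
  slice contains then depends on the mass left for the passive coordinates: without any, nonnegativity
  forces them to be zero, and with a positive amount they cannot all be zero.\<close>

section \<open>The likelihood\<close>

text \<open>The product is restricted to the active letters because \<open>0 powr 0\<close> is \<open>0\<close>, whereas a passive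
  letter has to contribute the factor \<open>1\<close> wherever \<open>q\<close> vanishes.\<close>

definition likelihood :: "real ^ 'n \<Rightarrow> real ^ 'n \<Rightarrow> real" where
  "likelihood \<nu> q = (\<Prod>i\<in>active_set \<nu>. (q $ i) powr (\<nu> $ i))"

lemma likelihood_nonneg: "0 \<le> likelihood \<nu> q"
  by (simp add: likelihood_def prod_nonneg)

lemma likelihood_pos_iff:
  assumes "\<And>i. 0 \<le> q $ i"
  shows "0 < likelihood \<nu> q \<longleftrightarrow> (\<forall>i\<in>active_set \<nu>. 0 < q $ i)"
proof -
  have "0 < likelihood \<nu> q \<longleftrightarrow> likelihood \<nu> q \<noteq> 0"
    using likelihood_nonneg[of \<nu> q] by linarith
  also have "\<dots> \<longleftrightarrow> (\<forall>i\<in>active_set \<nu>. q $ i \<noteq> 0)"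
    by (simp add: likelihood_def)
  also have "\<dots> \<longleftrightarrow> (\<forall>i\<in>active_set \<nu>. 0 < q $ i)"
    using assms by (metis less_le)
  finally show ?thesis .
qed

lemma likelihood_cong_active:
  assumes "\<And>i. i \<in> active_set \<nu> \<Longrightarrow> q $ i = r $ i"
  shows "likelihood \<nu> q = likelihood \<nu> r"
  unfolding likelihood_def by (rule prod.cong) (use assms in auto)

text \<open>Continuity reaches the boundary of the orthant because only letters with a positive
  exponent enter the product.\<close>

lemma continuous_on_likelihood:
  assumes "\<And>q i. q \<in> S \<Longrightarrow> 0 \<le> q $ i"
  shows "continuous_on S (likelihood \<nu>)"
  unfolding likelihood_def
proof (rule continuous_on_prod)
  fix i assume "i \<in> active_set \<nu>"
  then show "continuous_on S (\<lambda>q. (q $ i) powr (\<nu> $ i))"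
    using assms
    by (intro continuous_on_powr' continuous_intros)
      (auto simp: active_set_def)
qed

text \<open>If an active letter has probability \<open>0\<close>, its summand is $-\infty$. No summand is $+\infty$, so
  this one determines the sum, in agreement with the vanishing product.\<close>

lemma loss_eq_likelihood:
  assumes \<nu>: "\<And>i. 0 \<le> \<nu> $ i" and q: "\<And>i. 0 \<le> q $ i"
  shows "loss \<nu> q = - elog (likelihood \<nu> q)"
proof -
  let ?A = "active_set \<nu>" and ?f = "\<lambda>i. ereal (\<nu> $ i) * elog (q $ i)"
  have nu_zero: "\<nu> $ i = 0" if "i \<notin> ?A" for i
    using antisym[OF _ \<nu>[of i]] that by (simp add: active_set_def not_less)
  have "sum ?f UNIV = sum ?f ?A"
    by (rule sum.mono_neutral_right) (auto simp: nu_zero zero_ereal_def[symmetric])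
  then have loss: "loss \<nu> q = - sum ?f ?A"
    by (simp add: loss_def)
  show ?thesis
  proof (cases "\<forall>i\<in>?A. 0 < q $ i")
    case True
    have "sum ?f ?A = (\<Sum>i\<in>?A. ereal (\<nu> $ i * ln (q $ i)))"
      by (rule sum.cong) (use True in \<open>auto simp: elog_def\<close>)
    also have "\<dots> = ereal (ln (likelihood \<nu> q))"
    proof -
      have "ln (likelihood \<nu> q) = (\<Sum>i\<in>?A. ln ((q $ i) powr (\<nu> $ i)))"
        unfolding likelihood_def by (rule ln_prod) (use True in force)+
      also have "\<dots> = (\<Sum>i\<in>?A. \<nu> $ i * ln (q $ i))"
        by (rule sum.cong) (use True in \<open>auto simp: ln_powr\<close>)
      finally show ?thesis
        by simp
    qed
    finally show ?thesis
      using True likelihood_pos_iff[OF q, of \<nu>] unfolding loss by (simp add: elog_def)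
  next
    case False
    then obtain k where "k \<in> ?A" "\<not> 0 < q $ k"
      by blast
    with q[of k] have k: "k \<in> ?A" "q $ k = 0"
      by linarith+
    have f_k: "?f k = -\<infinity>"
      using k by (simp add: elog_def active_set_def)
    have "?f i \<noteq> \<infinity>" for i
      by (simp add: elog_def leD[OF \<nu>])
    then have rest: "sum ?f (?A - {k}) \<noteq> \<infinity>"
      by (simp only: sum_Pinfty) blast
    have "sum ?f ?A = ?f k + sum ?f (?A - {k})"
      by (rule sum.remove) (use k in auto)
    also have "\<dots> = -\<infinity>"
      unfolding f_k using rest by (cases "sum ?f (?A - {k})") simp_all
    finally have "sum ?f ?A = -\<infinity>" .
    moreover have "likelihood \<nu> q = 0"
      using k by (auto simp: likelihood_def)
    ultimately show ?thesis
      unfolding loss by (simp add: elog_def)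
  qed
qed

lemma elog_le_elog_iff:
  assumes "0 \<le> x" "0 \<le> y"
  shows "elog x \<le> elog y \<longleftrightarrow> x \<le> y"
  using assms by (auto simp: elog_def)

lemma elog_eq_elog_iff:
  assumes "0 \<le> x" "0 \<le> y"
  shows "elog x = elog y \<longleftrightarrow> x = y"
  using assms by (auto simp: elog_def)

section \<open>Strict concavity\<close>

text \<open>Coordinatewise this is the inequality of arithmetic and geometric means; it is stated with
  squares to avoid roots.\<close>

lemma likelihood_midpoint:
  assumes q: "\<And>i. i \<in> active_set \<nu> \<Longrightarrow> 0 < q $ i"
    and r: "\<And>i. i \<in> active_set \<nu> \<Longrightarrow> 0 < r $ i"
    and k: "k \<in> active_set \<nu>" "q $ k \<noteq> r $ k"
  shows "likelihood \<nu> q * likelihood \<nu> r < (likelihood \<nu> (midpoint q r))\<^sup>2"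
proof -
  let ?A = "active_set \<nu>" and ?m = "midpoint q r"
  have mid: "?m $ i = (q $ i + r $ i) / 2" for i
    by (simp add: midpoint_def)
  have gap: "(?m $ i)\<^sup>2 - q $ i * r $ i = ((q $ i - r $ i) / 2)\<^sup>2" for i
    by (simp add: mid power2_eq_square field_simps)
  have le: "q $ i * r $ i \<le> (?m $ i)\<^sup>2" for i
    using gap[of i] zero_le_power2[of "(q $ i - r $ i) / 2"] by linarith
  have lt: "q $ k * r $ k < (?m $ k)\<^sup>2"
  proof -
    have "0 < ((q $ k - r $ k) / 2)\<^sup>2"
      using k(2) by simp
    then show ?thesis
      using gap[of k] by linarith
  qed
  have "likelihood \<nu> q * likelihood \<nu> r = (\<Prod>i\<in>?A. (q $ i * r $ i) powr (\<nu> $ i))"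
    unfolding likelihood_def prod.distrib[symmetric]
    by (rule prod.cong) (use q r in \<open>auto simp: powr_mult less_imp_le\<close>)
  also have "\<dots> < (\<Prod>i\<in>?A. ((?m $ i)\<^sup>2) powr (\<nu> $ i))"
  proof (rule prod_mono_strict[OF k(1)])
    fix i assume i: "i \<in> ?A"
    show "0 \<le> (q $ i * r $ i) powr (\<nu> $ i) \<and>
        (q $ i * r $ i) powr (\<nu> $ i) \<le> ((?m $ i)\<^sup>2) powr (\<nu> $ i)"
      using q[OF i] r[OF i] le[of i] i by (auto intro!: powr_mono2 simp: active_set_def)
    have "0 < ?m $ i"
      using q[OF i] r[OF i] by (simp add: mid)
    then show "0 < ((?m $ i)\<^sup>2) powr (\<nu> $ i)"
      by simp
  next
    show "(q $ k * r $ k) powr (\<nu> $ k) < ((?m $ k)\<^sup>2) powr (\<nu> $ k)"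
      using q[OF k(1)] r[OF k(1)] lt k(1) by (intro powr_less_mono2) (auto simp: active_set_def)
  qed auto
  also have "\<dots> = (likelihood \<nu> ?m)\<^sup>2"
    unfolding likelihood_def prod_power_distrib
  proof (rule prod.cong[OF refl])
    fix i assume "i \<in> ?A"
    then have "0 \<le> ?m $ i"
      using q r by (simp add: mid add_nonneg_nonneg less_imp_le)
    then show "((?m $ i)\<^sup>2) powr (\<nu> $ i) = (?m $ i powr (\<nu> $ i))\<^sup>2"
      by (simp add: power2_eq_square powr_mult)
  qed
  finally show ?thesis .
qed

section \<open>Subsets of the simplex\<close>

lemma compact_subset_prob_simplex:
  assumes "closed C" "C \<subseteq> prob_simplex"
  shows "compact C"
proof -
  have "norm q \<le> 1" if "q \<in> C" for q
    using that assms(2) norm_le_l1_cart[of q] by (auto simp: prob_simplex_def)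
  then show ?thesis
    using assms(1) by (auto simp: compact_eq_bounded_closed bounded_iff)
qed

text \<open>Averaging, over all letters, points that charge the given letter leaves no coordinate zero,
  since the other points cannot cancel a positive contribution.\<close>

lemma full_support_imp_positive_point:
  fixes C :: "(real ^ 'n) set"
  assumes "convex C" "support C = UNIV" and nonneg: "\<And>q i. q \<in> C \<Longrightarrow> 0 \<le> q $ i"
  obtains q where "q \<in> C" "\<And>i. 0 < q $ i"
proof -
  have "\<forall>i. \<exists>q\<in>C. 0 < q $ i"
    using assms(2) by (auto simp: support_def)
  then obtain p where p: "\<And>i. p i \<in> C" "\<And>i. 0 < p i $ i"
    by metis
  let ?q = "\<Sum>i\<in>UNIV. (1 / real CARD('n)) *\<^sub>R p i"
  have "?q \<in> C"
    by (rule convex_sum) (use assms(1) p in auto)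
  moreover have "0 < ?q $ i" for i
    using p nonneg by (auto intro!: sum_pos2[of _ i])
  ultimately show ?thesis
    using that by blast
qed

section \<open>Active and passive coordinates\<close>

lemma passive_set_eq:
  assumes "\<nu> \<in> prob_simplex"
  shows "passive_set \<nu> = - active_set \<nu>"
  using assms by (auto simp: prob_simplex_def active_set_def passive_set_def less_le)

lemma sum_active_passive:
  assumes "\<nu> \<in> prob_simplex"
  shows "(\<Sum>i\<in>UNIV. x $ i) = (\<Sum>i\<in>active_set \<nu>. x $ i) + (\<Sum>i\<in>passive_set \<nu>. x $ i)"
  using sum.subset_diff[of "active_set \<nu>" UNIV "($) x"]
  by (simp add: passive_set_eq[OF assms] Compl_eq_Diff_UNIV add.commute)

lemma join_active: "i \<in> active_set \<nu> \<Longrightarrow> join \<nu> (xa, xp) $ i = xa i"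
  by (simp add: join_def)

lemma join_passive: "i \<in> passive_set \<nu> \<Longrightarrow> join \<nu> (xa, xp) $ i = xp i"
  by (simp add: join_def active_set_def passive_set_def)

lemma inj_on_join_slice:
  assumes "\<nu> \<in> prob_simplex" "xa \<in> extensional (active_set \<nu>)"
  shows "inj_on (join \<nu>) ({xa} \<times> slice_passive \<nu> C xa)"
  by (rule inj_on_subset[OF bij_betw_imp_inj_on[OF bij_betw_join[OF assms(1)]]])
    (use assms(2) in \<open>auto simp: slice_passive_def\<close>)

text \<open>Turns a product of a point with its slice into a condition on elements of \<open>C\<close>, the form in
  which uniqueness of the active part is proved.\<close>

lemma join_slice_eq:
  assumes "\<nu> \<in> prob_simplex" "xa \<in> extensional (active_set \<nu>)"
  shows "join \<nu> ` ({xa} \<times> slice_passive \<nu> C xa) = {q \<in> C. proj_active \<nu> q = xa}"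
proof (intro equalityI subsetI)
  fix q assume "q \<in> join \<nu> ` ({xa} \<times> slice_passive \<nu> C xa)"
  then show "q \<in> {q \<in> C. proj_active \<nu> q = xa}"
    using assms(2)
    by (auto simp: slice_passive_def proj_active_def join_active fun_eq_iff extensional_def)
next
  fix q assume "q \<in> {q \<in> C. proj_active \<nu> q = xa}"
  moreover from this have "q = join \<nu> (xa, restrict (($) q) (passive_set \<nu>))"
    using passive_set_eq[OF assms(1)] by (auto simp: join_def proj_active_def vec_eq_iff)
  ultimately show "q \<in> join \<nu> ` ({xa} \<times> slice_passive \<nu> C xa)"
    by (auto simp: slice_passive_def intro!: rev_image_eqI)
qed

lemma sum_passive_slice:
  assumes "\<nu> \<in> prob_simplex" "C \<subseteq> prob_simplex" "xp \<in> slice_passive \<nu> C xa"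
  shows "(\<Sum>i\<in>passive_set \<nu>. xp i) = 1 - (\<Sum>i\<in>active_set \<nu>. xa i)"
proof -
  have "(\<Sum>i\<in>UNIV. join \<nu> (xa, xp) $ i) = 1"
    using assms(2,3) by (auto simp: slice_passive_def prob_simplex_def)
  then show ?thesis
    by (simp add: sum_active_passive[OF assms(1)] join_active join_passive)
qed

text \<open>The active coordinates use up the total mass, and nonnegative numbers that sum to \<open>0\<close> vanish.\<close>

lemma slice_eq_zero_passive:
  assumes "\<nu> \<in> prob_simplex" "C \<subseteq> prob_simplex" "xp \<in> slice_passive \<nu> C xa"
    and "(\<Sum>i\<in>active_set \<nu>. xa i) = 1"
  shows "xp = zero_passive \<nu>"
proof -
  have "0 \<le> xp i" if "i \<in> passive_set \<nu>" for i
    using assms(2,3)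
    by (auto simp: slice_passive_def prob_simplex_def simp flip: join_passive[OF that, of xa xp])
  then have "xp i = 0" if "i \<in> passive_set \<nu>" for i
    using sum_passive_slice[OF assms(1-3)] assms(4) that
    by (simp add: sum_nonneg_eq_0_iff)
  then show ?thesis
    using assms(3) by (auto simp: slice_passive_def zero_passive_def extensional_def fun_eq_iff)
qed

section \<open>Solutions of the primal problem\<close>

theorem theorem2:
  fixes \<nu> :: "real ^ 'n" and C :: "(real ^ 'n) set"
  assumes "\<nu> \<in> prob_simplex"
    and "convex C" and "closed C" and "C \<subseteq> prob_simplex"
    and "support C = UNIV"
  shows "\<bar>primal_value \<nu> C\<bar> \<noteq> \<infinity> \<and> compact (primal_solutions \<nu> C) \<and>
    (\<exists>qa \<in> proj_active \<nu> ` C.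
      (\<forall>i\<in>active_set \<nu>. 0 < qa i) \<and>
      primal_solutions \<nu> C = join \<nu> ` ({qa} \<times> slice_passive \<nu> C qa) \<and>
      ((\<Sum>i\<in>active_set \<nu>. qa i) = 1 \<longrightarrow>
        slice_passive \<nu> C qa = {zero_passive \<nu>} \<and>
        primal_solutions \<nu> C = {join \<nu> (qa, zero_passive \<nu>)}) \<and>
      ((\<Sum>i\<in>active_set \<nu>. qa i) < 1 \<longrightarrow>
        zero_passive \<nu> \<notin> slice_passive \<nu> C qa \<and>
        (is_singleton (primal_solutions \<nu> C) \<longleftrightarrow>
          is_singleton (slice_passive \<nu> C qa))))"
proof -
  let ?g = "likelihood \<nu>" and ?A = "active_set \<nu>" and ?S = "primal_solutions \<nu> C"
  have \<nu>: "0 \<le> \<nu> $ i" for i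
    using assms(1) by (simp add: prob_simplex_def)
  have C: "0 \<le> q $ i" if "q \<in> C" for q i
    using that assms(4) by (auto simp: prob_simplex_def)
  have loss: "loss \<nu> q = - elog (?g q)" if "q \<in> C" for q
    using loss_eq_likelihood[OF \<nu> C[OF that]] .
  have cont: "continuous_on C ?g"
    using C by (rule continuous_on_likelihood)
  have "compact C"
    using compact_subset_prob_simplex assms(3,4) .
  obtain q0 where q0: "q0 \<in> C" "\<And>i. 0 < q0 $ i"
    using full_support_imp_positive_point[OF assms(2,5)] C by metis
  obtain h where h: "h \<in> C" "\<And>q. q \<in> C \<Longrightarrow> ?g q \<le> ?g h"
    using continuous_attains_sup[OF \<open>compact C\<close> _ cont] q0(1) by blast
  have "0 < ?g q0"
    using q0 by (simp add: likelihood_pos_iff less_imp_le)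
  then have h_pos: "0 < ?g h"
    using h(2)[OF q0(1)] by linarith

  have opt_value: "primal_value \<nu> C = loss \<nu> h"
    unfolding primal_value_def
  proof (rule antisym)
    show "(INF q\<in>C. loss \<nu> q) \<le> loss \<nu> h"
      using h(1) by (rule INF_lower)
    show "loss \<nu> h \<le> (INF q\<in>C. loss \<nu> q)"
      by (rule INF_greatest) (simp add: loss h elog_le_elog_iff likelihood_nonneg)
  qed
  have finite_value: "\<bar>primal_value \<nu> C\<bar> \<noteq> \<infinity>"
    using h_pos by (simp add: opt_value loss[OF h(1)] elog_def)
  have S_level: "?S = {q \<in> C. ?g q = ?g h}"
    by (auto simp: primal_solutions_def opt_value loss h(1) elog_eq_elog_iff likelihood_nonneg)
  have "closed ?S"
    unfolding S_level using continuous_closed_preimage_constant[OF cont assms(3)] .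
  then have compact_S: "compact ?S"
    using compact_Int_closed[OF \<open>compact C\<close>, of ?S]
    by (simp add: S_level Int_absorb1)

  define qa where "qa = proj_active \<nu> h"
  have qa_ext: "qa \<in> extensional ?A" and qa_in: "qa \<in> proj_active \<nu> ` C"
    using h(1) by (auto simp: qa_def proj_active_def)
  have qa_pos: "\<forall>i\<in>?A. 0 < qa i"
    using h_pos likelihood_pos_iff[OF C[OF h(1)]] by (simp add: qa_def proj_active_def)
  have S_active: "?S = {q \<in> C. proj_active \<nu> q = qa}"
  proof (intro equalityI subsetI)
    fix q assume "q \<in> ?S"
    then have q: "q \<in> C" "?g q = ?g h"
      by (auto simp: S_level)
    have pos: "0 < q $ i" "0 < h $ i" if "i \<in> ?A" for i
      using likelihood_pos_iff[OF C[OF q(1)], of \<nu>] likelihood_pos_iff[OF C[OF h(1)], of \<nu>] h_pos that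
      by (auto simp: q(2))
    \<comment> \<open>If \<open>q\<close> and \<open>h\<close> differed at an active letter, their midpoint would beat the maximum.\<close>
    have mid: "midpoint q h \<in> C"
      using convexD[OF assms(2) q(1) h(1), of "1/2" "1/2"]
      by (simp add: midpoint_def scaleR_add_right)
    have "q $ k = h $ k" if "k \<in> ?A" for k
    proof (rule ccontr)
      assume "q $ k \<noteq> h $ k"
      with likelihood_midpoint[OF pos that] have "(?g h)\<^sup>2 < (?g (midpoint q h))\<^sup>2"
        by (simp add: q(2) power2_eq_square)
      then have "?g h < ?g (midpoint q h)"
        by (rule power2_less_imp_less[OF _ likelihood_nonneg])
      with h(2)[OF mid] show False
        by simp
    qed
    with q(1) show "q \<in> {q \<in> C. proj_active \<nu> q = qa}"
      by (auto simp: qa_def proj_active_def fun_eq_iff)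
  next
    fix q assume q: "q \<in> {q \<in> C. proj_active \<nu> q = qa}"
    then have "q $ i = h $ i" if "i \<in> ?A" for i
      using that by (auto simp: qa_def proj_active_def dest!: fun_cong[of _ _ i])
    then have "?g q = ?g h"
      by (rule likelihood_cong_active)
    with q show "q \<in> ?S"
      by (simp add: S_level)
  qed
  have S_join: "?S = join \<nu> ` ({qa} \<times> slice_passive \<nu> C qa)"
    using join_slice_eq[OF assms(1) qa_ext] S_active by simp
  have "h \<in> ?S"
    using h(1) by (simp add: S_level)
  then have slice_ne: "slice_passive \<nu> C qa \<noteq> {}"
    unfolding S_join by auto

  have a: "slice_passive \<nu> C qa = {zero_passive \<nu>}" if "(\<Sum>i\<in>?A. qa i) = 1"
    using slice_eq_zero_passive[OF assms(1,4) _ that] slice_ne by blast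
  have b: "zero_passive \<nu> \<notin> slice_passive \<nu> C qa" if "(\<Sum>i\<in>?A. qa i) < 1"
  proof
    assume "zero_passive \<nu> \<in> slice_passive \<nu> C qa"
    from sum_passive_slice[OF assms(1,4) this] that show False
      by (simp add: zero_passive_def)
  qed
  \<comment> \<open>A singleton is a set of cardinality \<open>1\<close>, and joining with \<open>qa\<close> is injective on the slice.\<close>
  have "card ?S = card (slice_passive \<nu> C qa)"
    using card_image[OF inj_on_join_slice[OF assms(1) qa_ext, of C]]
    by (simp add: S_join card_cartesian_product)
  then have single: "is_singleton ?S \<longleftrightarrow> is_singleton (slice_passive \<nu> C qa)"
    by (simp add: is_singleton_altdef)
  show ?thesis
    using finite_value compact_S
  proof (intro conjI bexI[OF _ qa_in] impI)
    assume one: "(\<Sum>i\<in>?A. qa i) = 1"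
    show "?S = {join \<nu> (qa, zero_passive \<nu>)}"
      unfolding S_join a[OF one] by simp
  qed (use qa_pos S_join a b single in auto)
qed

end
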